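(* Let $\mathcal{M}''_m$ be a meridian surface of hyperbolic type in the Minkowski space $\mathbb{R}^4_1$, parameterized by $z(u,v) = f(u)\, l(v) + g(u)\, e_1$, $u\in I$, $v\in J$, constructed from the meridian curve $m:u\mapsto(f(u),g(u))$ and the curve $c:l=l(v)$ with spherical curvature $\kappa$. The Gauss map $G$ of $\mathcal{M}''_m$ is harmonic (i.e. $\Delta G=0$) if and only if one of the following cases holds: (i) $\mathcal{M}''_m$ is part of a plane; (ii) the curve $c$ has spherical curvature $\kappa=\pm1$ and the meridian curve $m$ is determined by $f(u)=a$, $g(u)=\pm u+b$, where $a=\mathrm{const}$, $b=\mathrm{const}$. In this case $\mathcal{M}''_m$ is a marginally trapped developable ruled surface in $\mathbb{R}^4_1$.
   Context: $\mathbb{R}^4_1$ (also written $\mathbb{E}^4_1$) is the four-dimensional Minkowski space with flat metric $\langle\cdot,\cdot\rangle$ of signature $(3,1)$ and fixed orthonormal frame $e_1,e_2,e_3,e_4$, $\langle e_i,e_i\rangle=1$ for $i=1,2,3$, $\langle e_4,e_4\rangle=-1$. Meridian surface of hyperbolic type: let $f,g:I\to\mathbb{R}$ be smooth functions on an interval $I\subset\mathbb{R}$ with $f(u)>0$ and $(f'(u))^2+(g'(u))^2=1$ for all $u\in I$ (the plane curve $m:u\mapsto(f(u),g(u))$ is called the meridian curve). Let $c:l=l(v)$, $v\in J$ ($J\subset\mathbb{R}$ an interval), be a smooth curve with $\langle l',l'\rangle=1$ on the de Sitter space $S^2_1(1)=\{V\in\mathbb{R}^3_1:\langle V,V\rangle=1\}$,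 where $\mathbb{R}^3_1=\operatorname{span}\{e_2,e_3,e_4\}$. The surface $\mathcal{M}''_m:z(u,v)=f(u)\,l(v)+g(u)\,e_1$, $u\in I,\ v\in J$, is called a meridian surface of hyperbolic type; it is spacelike with first fundamental form $du^2+f^2(u)\,dv^2$. Spherical curvature of $c$: put $t=l'$ and let $n(v)$ be the (unique up to sign) vector field such that $\{l,t,n\}$ is an orthonormal frame field of $\mathbb{R}^3_1$, with $\langle n,n\rangle=-1$; then $\kappa(v)=\langle t'(v),n(v)\rangle$, and $l'=t$, $t'=-\kappa n-l$, $n'=-\kappa t$. Gauss map: with $x=z_u$ and $y=z_v/f$ (an orthonormal tangent frame), the Gauss map is $G=x\wedge y$, regarded as a map from the surface into the vector space $\wedge^2\mathbb{R}^4_1$, equipped with the indefinite inner product $\langle a_1\wedge a_2,b_1\wedge b_2\rangle=\det(\langle a_k,b_l\rangle)$. Laplacian: $\Delta G=-\nabla'_x\nabla'_xG+\nabla'_{\nabla_xx}G-\nabla'_y\nabla'_yG+\nabla'_{\nabla_yy}G$, where $\nabla'$ is the flat connection of the ambient space (componentwise differentiation) and $\nabla$ is the Levi-Civita connection of the surface. A spacelike surface is marginally trapped if its mean curvature vector field $H=\frac12\operatorname{tr}\sigma$ ($\sigma$ the second fundamental form) satisfies $H\neq0$ and $\langle H,H\rangle=0$ at each point. A ruled surface is developable if its tangent plane (equivalently its normal space) is constant along each generator. *)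

theory Defs
  imports "HOL-Analysis.Analysis"
begin

section \<open>Minkowski space and its second exterior power\<close>

definition mink :: "real^4 \<Rightarrow> real^4 \<Rightarrow> real" where
  "mink a b = a$1 * b$1 + a$2 * b$2 + a$3 * b$3 - a$4 * b$4"

abbreviation frame_vec :: "4 \<Rightarrow> real^4" where
  "frame_vec i \<equiv> axis i 1"

definition mink3 :: "(real^4) set" where
  "mink3 = span {frame_vec 2, frame_vec 3, frame_vec 4}"

definition de_sitter :: "(real^4) set" where
  "de_sitter = {V \<in> mink3. mink V V = 1}"

text \<open>The second exterior power of the ambient space is realised as the space of antisymmetric
  contravariant 2-tensors (4 by 4 matrices): the entries with row index smaller than column index
  are the coordinates with respect to the basis of wedge products of frame vectors.\<close>

definition wedge :: "real^4 \<Rightarrow> real^4 \<Rightarrow> real^4^4" where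
  "wedge a b = (\<chi> i j. a$i * b$j - a$j * b$i)"

definition wedge_inner :: "real^4^4 \<Rightarrow> real^4^4 \<Rightarrow> real" where
  "wedge_inner A B = 1/2 * (\<Sum>i\<in>UNIV. \<Sum>j\<in>UNIV.
     mink (frame_vec i) (frame_vec i) * mink (frame_vec j) (frame_vec j) * A$i$j * B$i$j)"

lemma wedge_inner_wedge:
  "wedge_inner (wedge a1 a2) (wedge b1 b2)
     = det (vector [vector [mink a1 b1, mink a1 b2], vector [mink a2 b1, mink a2 b2]] :: real^2^2)"
  unfolding wedge_inner_def wedge_def mink_def det_2
  by (simp add: sum_4 axis_def vector_2 algebra_simps)


section \<open>Calculus on intervals\<close>

text \<open>Parameter intervals may contain their endpoints; all derivatives are therefore taken within
  the interval (one-sided at an endpoint). On an open interval they are the usual ones.\<close>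

definition smooth_on_interval :: "real set \<Rightarrow> (real \<Rightarrow> 'a::real_normed_vector) \<Rightarrow> bool" where
  "smooth_on_interval S h \<longleftrightarrow>
     (\<exists>D :: nat \<Rightarrow> real \<Rightarrow> 'a. D 0 = h \<and>
        (\<forall>k. \<forall>s\<in>S. (D k has_vector_derivative D (Suc k) s) (at s within S)))"

definition deriv_on :: "real set \<Rightarrow> (real \<Rightarrow> 'a::real_normed_vector) \<Rightarrow> real \<Rightarrow> 'a" where
  "deriv_on S h s = vector_derivative h (at s within S)"

text \<open>Index 1 refers to the first parameter (in \<open>I\<close>), index 2 to the second (in \<open>J\<close>).\<close>

definition partial_deriv ::
  "real set \<Rightarrow> real set \<Rightarrow> 2 \<Rightarrow> (real \<Rightarrow> real \<Rightarrow> 'a::real_normed_vector) \<Rightarrow> real \<Rightarrow> real \<Rightarrow> 'a" where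
  "partial_deriv I J i \<Phi> u v =
     (if i = 1 then deriv_on I (\<lambda>s. \<Phi> s v) u else deriv_on J (\<lambda>s. \<Phi> u s) v)"


section \<open>Parametrized surfaces\<close>

text \<open>A tangent vector field on a parametrized surface is given by its coefficients with respect to
  the coordinate fields. \<open>flat_deriv\<close> differentiates a function along such a field componentwise
  (the flat connection of the target vector space); applied to the parametrization itself it yields
  the tangent vector as a vector of the ambient space.\<close>

type_synonym tangent_field = "real \<Rightarrow> real \<Rightarrow> real^2"

definition coord_field :: "2 \<Rightarrow> tangent_field" where
  "coord_field i = (\<lambda>u v. axis i 1)"

definition flat_deriv ::
  "real set \<Rightarrow> real set \<Rightarrow> tangent_field \<Rightarrow> (real \<Rightarrow> real \<Rightarrow> 'a::real_normed_vector) \<Rightarrow> real \<Rightarrow> real \<Rightarrow> 'a"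
  where
  "flat_deriv I J X \<Phi> u v = (\<Sum>i\<in>UNIV. (X u v $ i) *\<^sub>R partial_deriv I J i \<Phi> u v)"

definition first_fundamental_form ::
  "real set \<Rightarrow> real set \<Rightarrow> (real \<Rightarrow> real \<Rightarrow> real^4) \<Rightarrow> real \<Rightarrow> real \<Rightarrow> real^2^2" where
  "first_fundamental_form I J z u v =
     (\<chi> i j. mink (partial_deriv I J i z u v) (partial_deriv I J j z u v))"

definition spacelike_surface ::
  "real set \<Rightarrow> real set \<Rightarrow> (real \<Rightarrow> real \<Rightarrow> real^4) \<Rightarrow> bool" where
  "spacelike_surface I J z \<longleftrightarrow>
     (\<forall>u\<in>I. \<forall>v\<in>J. \<forall>w. w \<noteq> 0 \<longrightarrow> w \<bullet> (first_fundamental_form I J z u v *v w) > 0)"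

definition christoffel ::
  "real set \<Rightarrow> real set \<Rightarrow> (real \<Rightarrow> real \<Rightarrow> real^4) \<Rightarrow> 2 \<Rightarrow> 2 \<Rightarrow> 2 \<Rightarrow> real \<Rightarrow> real \<Rightarrow> real" where
  "christoffel I J z k i j u v =
     (let gm = (\<lambda>a b u v. first_fundamental_form I J z u v $ a $ b);
          ginv = matrix_inv (first_fundamental_form I J z u v)
      in 1/2 * (\<Sum>m\<in>UNIV. ginv $ k $ m *
           (partial_deriv I J i (gm j m) u v + partial_deriv I J j (gm i m) u v
            - partial_deriv I J m (gm i j) u v)))"

definition levi_civita ::
  "real set \<Rightarrow> real set \<Rightarrow> (real \<Rightarrow> real \<Rightarrow> real^4) \<Rightarrow> tangent_field \<Rightarrow> tangent_field \<Rightarrow> tangent_field"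
  where
  "levi_civita I J z X W u v =
     (\<chi> k. \<Sum>i\<in>UNIV. X u v $ i *
        (partial_deriv I J i (\<lambda>u v. W u v $ k) u v
         + (\<Sum>j\<in>UNIV. christoffel I J z k i j u v * W u v $ j)))"

text \<open>The second fundamental form is defined by the Gauss formula.\<close>

definition second_fundamental_form ::
  "real set \<Rightarrow> real set \<Rightarrow> (real \<Rightarrow> real \<Rightarrow> real^4) \<Rightarrow> tangent_field \<Rightarrow> tangent_field
     \<Rightarrow> real \<Rightarrow> real \<Rightarrow> real^4" where
  "second_fundamental_form I J z X W u v =
     flat_deriv I J X (flat_deriv I J W z) u v - flat_deriv I J (levi_civita I J z X W) z u v"

definition mean_curvature ::
  "real set \<Rightarrow> real set \<Rightarrow> (real \<Rightarrow> real \<Rightarrow> real^4) \<Rightarrow> real \<Rightarrow> real \<Rightarrow> real^4" where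
  "mean_curvature I J z u v =
     (1/2) *\<^sub>R (\<Sum>i\<in>UNIV. \<Sum>j\<in>UNIV. (matrix_inv (first_fundamental_form I J z u v) $ i $ j)
        *\<^sub>R second_fundamental_form I J z (coord_field i) (coord_field j) u v)"

definition marginally_trapped ::
  "real set \<Rightarrow> real set \<Rightarrow> (real \<Rightarrow> real \<Rightarrow> real^4) \<Rightarrow> bool" where
  "marginally_trapped I J z \<longleftrightarrow> spacelike_surface I J z \<and>
     (\<forall>u\<in>I. \<forall>v\<in>J. mean_curvature I J z u v \<noteq> 0 \<and>
        mink (mean_curvature I J z u v) (mean_curvature I J z u v) = 0)"

text \<open>The generators of the ruling are the parameter lines with constant second parameter.\<close>

definition developable_ruled ::
  "real set \<Rightarrow> real set \<Rightarrow> (real \<Rightarrow> real \<Rightarrow> real^4) \<Rightarrow> bool" where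
  "developable_ruled I J z \<longleftrightarrow>
     (\<exists>\<alpha> \<delta>. smooth_on_interval J \<alpha> \<and> smooth_on_interval J \<delta> \<and> (\<forall>v\<in>J. \<delta> v \<noteq> 0) \<and>
        (\<forall>u\<in>I. \<forall>v\<in>J. z u v = \<alpha> v + u *\<^sub>R \<delta> v)) \<and>
     (\<forall>v\<in>J. \<forall>u1\<in>I. \<forall>u2\<in>I.
        span {partial_deriv I J 1 z u1 v, partial_deriv I J 2 z u1 v}
        = span {partial_deriv I J 1 z u2 v, partial_deriv I J 2 z u2 v})"

definition part_of_plane ::
  "real set \<Rightarrow> real set \<Rightarrow> (real \<Rightarrow> real \<Rightarrow> real^4) \<Rightarrow> bool" where
  "part_of_plane I J z \<longleftrightarrow>
     (\<exists>P. affine P \<and> aff_dim P = 2 \<and> (\<forall>u\<in>I. \<forall>v\<in>J. z u v \<in> P))"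

text \<open>In the next two definitions \<open>X\<close>, \<open>Y\<close> is meant to be an orthonormal tangent frame.\<close>

definition gauss_map ::
  "real set \<Rightarrow> real set \<Rightarrow> (real \<Rightarrow> real \<Rightarrow> real^4) \<Rightarrow> tangent_field \<Rightarrow> tangent_field
     \<Rightarrow> real \<Rightarrow> real \<Rightarrow> real^4^4" where
  "gauss_map I J z X Y u v = wedge (flat_deriv I J X z u v) (flat_deriv I J Y z u v)"

definition laplacian ::
  "real set \<Rightarrow> real set \<Rightarrow> (real \<Rightarrow> real \<Rightarrow> real^4) \<Rightarrow> tangent_field \<Rightarrow> tangent_field
     \<Rightarrow> (real \<Rightarrow> real \<Rightarrow> 'a::real_normed_vector) \<Rightarrow> real \<Rightarrow> real \<Rightarrow> 'a" where
  "laplacian I J z X Y \<Phi> u v =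
     - flat_deriv I J X (flat_deriv I J X \<Phi>) u v + flat_deriv I J (levi_civita I J z X X) \<Phi> u v
     - flat_deriv I J Y (flat_deriv I J Y \<Phi>) u v + flat_deriv I J (levi_civita I J z Y Y) \<Phi> u v"


section \<open>Meridian surfaces of hyperbolic type\<close>

definition meridian_surface ::
  "(real \<Rightarrow> real) \<Rightarrow> (real \<Rightarrow> real) \<Rightarrow> (real \<Rightarrow> real^4) \<Rightarrow> real \<Rightarrow> real \<Rightarrow> real^4" where
  "meridian_surface f g l u v = f u *\<^sub>R l v + g u *\<^sub>R frame_vec 1"

text \<open>The orthonormal frame consisting of the first coordinate field and the second coordinate
  field divided by \<open>f\<close>.\<close>

definition frame_x :: tangent_field where
  "frame_x = coord_field 1"

definition frame_y :: "(real \<Rightarrow> real) \<Rightarrow> tangent_field" where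
  "frame_y f = (\<lambda>u v. (1 / f u) *\<^sub>R coord_field 2 u v)"

definition harmonic_gauss_map ::
  "real set \<Rightarrow> real set \<Rightarrow> (real \<Rightarrow> real) \<Rightarrow> (real \<Rightarrow> real) \<Rightarrow> (real \<Rightarrow> real^4) \<Rightarrow> bool" where
  "harmonic_gauss_map I J f g l \<longleftrightarrow>
     (let z = meridian_surface f g l; X = frame_x; Y = frame_y f
      in \<forall>u\<in>I. \<forall>v\<in>J. laplacian I J z X Y (gauss_map I J z X Y) u v = 0)"

definition spherical_curvature ::
  "real set \<Rightarrow> (real \<Rightarrow> real^4) \<Rightarrow> (real \<Rightarrow> real^4) \<Rightarrow> real \<Rightarrow> real" where
  "spherical_curvature J l n v = mink (deriv_on J (deriv_on J l) v) (n v)"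

end

theory Submission
  imports Defs
begin

text \<open>Along the curve, $l, t, n$ and $e_1$ form a pseudo-orthonormal frame, so $\Delta G$ expands in
  linearly independent bivectors built from them, and harmonicity becomes a system of scalar
  equations, among them $f'\kappa = 0$. If $\kappa \neq 0$ somewhere, then $f' = 0$ and
  $g' = \pm 1$, and the $e_1 \wedge t$ component forces $\kappa^2 = 1$. If $\kappa = 0$, adding $f'$ times the
  $l \wedge t$ component and $g'$ times the $e_1 \wedge t$ component, and using the
  derivatives of $f'^2 + g'^2 = 1$, gives $f^2 (f''^2 + g''^2) + g'^2 = 0$; hence $g' = 0$ and the
  surface is planar.\<close>

section \<open>Minkowski products and bivectors\<close>

text \<open>The exceptional case exists because \<open>n\<close> is timelike. Differentiating G
  twice along the curve, the \<open>n\<close> part of t' returns +\<kappa>^2 and its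
  \<open>l\<close> part returns -1, so the \<open>wedge e (t v)\<close> coefficient carries
  \<kappa>^2 - 1, which can vanish; for a spacelike normal both contributions would have the same
  sign. The same number decides the causal type of the mean curvature vector: once f' = 0, it is a
  multiple of \<kappa> n + l, whose square is 1 - \<kappa>^2. The equations hold point by point,
  while both alternatives are global statements. In the cylindrical case the signs are therefore not
  chosen pointwise: g' and \<kappa> are shown to have zero derivative, hence to be constant, and
  only then is the value 1 or -1 read off. For the converse from planes, containment is turned into
  a statement about derivatives: the tangent vectors and t' all lie in the two-dimensional direction
  space, and this fixes both \<kappa> and g'.\<close>

lemma mink_commute: "mink a b = mink b a"
  by (simp add: mink_def mult.commute)

lemma bounded_bilinear_mink: "bounded_bilinear mink"
  unfolding bilinear_conv_bounded_bilinear[symmetric] bilinear_def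
  by (auto intro!: linearI simp: mink_def algebra_simps)

lemma bounded_bilinear_wedge: "bounded_bilinear wedge"
  unfolding bilinear_conv_bounded_bilinear[symmetric] bilinear_def
  by (auto intro!: linearI simp: wedge_def vec_eq_iff algebra_simps)

lemmas mink_simps =
  bounded_bilinear.add_left[OF bounded_bilinear_mink]
  bounded_bilinear.add_right[OF bounded_bilinear_mink]
  bounded_bilinear.diff_left[OF bounded_bilinear_mink]
  bounded_bilinear.diff_right[OF bounded_bilinear_mink]
  bounded_bilinear.minus_left[OF bounded_bilinear_mink]
  bounded_bilinear.minus_right[OF bounded_bilinear_mink]
  bounded_bilinear.scaleR_left[OF bounded_bilinear_mink]
  bounded_bilinear.scaleR_right[OF bounded_bilinear_mink]
  bounded_bilinear.zero_left[OF bounded_bilinear_mink]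
  bounded_bilinear.zero_right[OF bounded_bilinear_mink]

lemmas wedge_simps =
  bounded_bilinear.add_left[OF bounded_bilinear_wedge]
  bounded_bilinear.add_right[OF bounded_bilinear_wedge]
  bounded_bilinear.diff_left[OF bounded_bilinear_wedge]
  bounded_bilinear.diff_right[OF bounded_bilinear_wedge]
  bounded_bilinear.minus_left[OF bounded_bilinear_wedge]
  bounded_bilinear.minus_right[OF bounded_bilinear_wedge]
  bounded_bilinear.scaleR_left[OF bounded_bilinear_wedge]
  bounded_bilinear.scaleR_right[OF bounded_bilinear_wedge]
  bounded_bilinear.zero_left[OF bounded_bilinear_wedge]
  bounded_bilinear.zero_right[OF bounded_bilinear_wedge]

lemmas has_vector_derivative_mink [derivative_intros] =
  bounded_bilinear.has_vector_derivative[OF bounded_bilinear_mink]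

lemmas has_vector_derivative_wedge [derivative_intros] =
  bounded_bilinear.has_vector_derivative[OF bounded_bilinear_wedge]

lemma wedge_self: "wedge a a = 0"
  by (simp add: wedge_def vec_eq_iff)

lemma wedge_inner_add: "wedge_inner (A + B) C = wedge_inner A C + wedge_inner B C"
  by (simp add: wedge_inner_def sum.distrib algebra_simps)

lemma wedge_inner_scaleR: "wedge_inner (r *\<^sub>R A) C = r * wedge_inner A C"
  by (simp add: wedge_inner_def sum_distrib_left algebra_simps)

lemma wedge_inner_zero: "wedge_inner 0 C = 0"
  by (simp add: wedge_inner_def)

text \<open>On bivectors built from a pseudo-orthonormal frame this Gram determinant is 0 for
  distinct pairs and 1 or -1 for equal ones, so pairing with such a bivector isolates a single
  coefficient of a combination.\<close>

lemma wedge_inner_decomposable: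
  "wedge_inner (wedge a b) (wedge c d) = mink a c * mink b d - mink a d * mink b c"
  by (simp add: wedge_inner_wedge det_2)

lemma mink3_component: "V \<in> mink3 \<Longrightarrow> mink V (frame_vec 1) = 0"
proof -
  assume "V \<in> mink3"
  moreover have "mink3 \<subseteq> {x. x $ 1 = 0}"
    unfolding mink3_def
    by (rule span_minimal) (auto simp: axis_def intro!: subspace_def[THEN iffD2])
  ultimately show ?thesis
    by (auto simp: mink_def axis_def)
qed

lemma mink_frame_vec_1: "mink (frame_vec 1) (frame_vec 1) = 1"
  by (simp add: mink_def axis_def)

text \<open>Products with the four vectors recover the coordinates of \<open>T x\<close> up to sign,
  so \<open>T\<close> is injective and, by equality of dimensions, surjective. The minus sign before
  the last term compensates \<open>mink d d = -1\<close>.\<close>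

lemma pseudo_orthonormal_expansion:
  fixes a b c d w :: "real^4"
  assumes "mink a a = 1" "mink b b = 1" "mink c c = 1" "mink d d = -1"
    and "mink a b = 0" "mink a c = 0" "mink a d = 0" "mink b c = 0" "mink b d = 0" "mink c d = 0"
  shows "w = mink w a *\<^sub>R a + mink w b *\<^sub>R b + mink w c *\<^sub>R c - mink w d *\<^sub>R d"
proof -
  have comm: "mink b a = 0" "mink c a = 0" "mink d a = 0" "mink c b = 0" "mink d b = 0"
      "mink d c = 0"
    using assms by (simp_all add: mink_commute)
  define T where "T x = x $ 1 *\<^sub>R a + x $ 2 *\<^sub>R b + x $ 3 *\<^sub>R c + x $ 4 *\<^sub>R d" for x :: "real^4"
  have coords: "mink (T x) a = x $ 1" "mink (T x) b = x $ 2" "mink (T x) c = x $ 3"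
      "mink (T x) d = - x $ 4" for x
    by (simp_all add: T_def mink_simps assms comm)
  have lin: "linear T"
    by (rule linearI) (simp_all add: T_def algebra_simps)
  have "inj T"
  proof (rule injI)
    fix x y assume "T x = T y"
    then have "x $ i = y $ i" for i
      using coords[of x] coords[of y] exhaust_4[of i] by auto
    then show "x = y" by (simp add: vec_eq_iff)
  qed
  then obtain x where "w = T x"
    using linear_injective_imp_surjective[OF lin] by (metis surjE)
  then show ?thesis
    using coords[of x] by (simp add: T_def)
qed

text \<open>\<open>matrix_inv\<close> is a choice, so \<open>B\<close> first serves as witness that
  the chosen matrix is an inverse; uniqueness of inverses then identifies the two.\<close>

lemma matrix_inv_eqI:
  fixes A :: "real^'n^'n"
  assumes "A ** B = mat 1" "B ** A = mat 1"
  shows "matrix_inv A = B"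
proof -
  have "A ** matrix_inv A = mat 1 \<and> matrix_inv A ** A = mat 1"
    unfolding matrix_inv_def by (rule someI[of _ B]) (simp add: assms)
  then show ?thesis
    by (metis assms(2) matrix_mul_assoc matrix_mul_lid matrix_mul_rid)
qed


section \<open>Derivatives within an interval\<close>

text \<open>Nonempty interior excludes a one-point interval, at which every vector would be a
  derivative within the set. Derivatives thus become unique, also one-sided ones at
  endpoints.\<close>

locale nondegenerate_interval =
  fixes S :: "real set"
  assumes interval: "is_interval S" and nondegenerate: "interior S \<noteq> {}"
begin

lemma nonempty: "S \<noteq> {}"
  using nondegenerate interior_subset by blast

lemma at_within_neq_bot: "s \<in> S \<Longrightarrow> at s within S \<noteq> bot"
proof -
  assume "s \<in> S"
  moreover have "S \<noteq> {x}" for x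
    using nondegenerate by auto
  moreover have "connected S"
    using interval by (simp add: is_interval_connected)
  ultimately have "s islimpt S"
    by (intro connected_imp_perfect)
  then show ?thesis
    by (simp add: trivial_limit_within)
qed

text \<open>The last premise lets \<open>k\<close> be replaced by a formula known only on
  \<open>S\<close>, as is the case for everything derived from the geometric hypotheses.\<close>

lemma deriv_on_eqI:
  assumes "s \<in> S" "(h has_vector_derivative d) (at s within S)" "\<And>x. x \<in> S \<Longrightarrow> k x = h x"
  shows "deriv_on S k s = d"
  unfolding deriv_on_def
  using assms at_within_neq_bot
  by (intro vector_derivative_within has_vector_derivative_transform[of s S k h]) auto

lemma derivative_unique:
  assumes "s \<in> S" "(h has_vector_derivative d) (at s within S)"
    and "(k has_vector_derivative d') (at s within S)" "\<And>x. x \<in> S \<Longrightarrow> k x = h x"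
  shows "d' = d"
  using deriv_on_eqI[OF assms(1,2,4)] deriv_on_eqI[OF assms(1,3)] by simp

lemma constant_if_derivative_zero:
  fixes h :: "real \<Rightarrow> 'a::real_normed_vector"
  assumes "\<And>s. s \<in> S \<Longrightarrow> (h has_vector_derivative 0) (at s within S)"
  obtains c where "\<And>s. s \<in> S \<Longrightarrow> h s = c"
  using has_vector_derivative_zero_constant assms interval is_interval_convex by blast

lemma smooth_imp_derivative:
  assumes "smooth_on_interval S h" "s \<in> S"
  shows "(h has_vector_derivative deriv_on S h s) (at s within S)"
proof -
  obtain d where "(h has_vector_derivative d) (at s within S)"
    using assms unfolding smooth_on_interval_def by metis
  then show ?thesis
    using deriv_on_eqI[OF assms(2)] by metis
qed

lemma smooth_deriv_on:
  assumes "smooth_on_interval S h"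
  shows "smooth_on_interval S (deriv_on S h)"
proof -
  obtain D where D: "D 0 = h"
      "\<And>k s. s \<in> S \<Longrightarrow> (D k has_vector_derivative D (Suc k) s) (at s within S)"
    using assms unfolding smooth_on_interval_def by blast
  \<comment> \<open>Shifting the sequence is not quite enough: entry 0 has to be the function
    \<open>deriv_on S h\<close> itself, which is known to agree with \<open>D 1\<close> only on
    \<open>S\<close>.\<close>
  define E where "E k = (if k = 0 then deriv_on S h else D (Suc k))" for k
  have E: "E k s = D (Suc k) s" if "s \<in> S" for k s
    using D deriv_on_eqI[OF that, of h] that unfolding E_def by (cases k) auto
  have "(E k has_vector_derivative E (Suc k) s) (at s within S)" if "s \<in> S" for k s
    using has_vector_derivative_transform[OF that E D(2)[OF that, of "Suc k"]] E[OF that]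
    by simp
  then show ?thesis
    unfolding smooth_on_interval_def by (intro exI[of _ E]) (auto simp: E_def)
qed

lemma smooth_imp_real_derivative:
  fixes h :: "real \<Rightarrow> real"
  assumes "smooth_on_interval S h" "s \<in> S"
  shows "(h has_real_derivative deriv_on S h s) (at s within S)"
  using smooth_imp_derivative[OF assms] by (simp add: has_real_derivative_iff_has_vector_derivative)

text \<open>Serves both coefficients of a ruling: the directrix, and with \<open>a = 0\<close> the
  constant direction of the generators.\<close>

lemma smooth_scaleR_add_const:
  assumes "smooth_on_interval S h"
  shows "smooth_on_interval S (\<lambda>s. a *\<^sub>R h s + c)"
proof -
  obtain D where D: "D 0 = h"
      "\<And>k s. s \<in> S \<Longrightarrow> (D k has_vector_derivative D (Suc k) s) (at s within S)"
    using assms unfolding smooth_on_interval_def by blast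
  have "((\<lambda>s. a *\<^sub>R D k s + b) has_vector_derivative a *\<^sub>R D (Suc k) s) (at s within S)"
    if "s \<in> S" for k s b
    using D(2)[OF that, of k] by (auto intro!: derivative_eq_intros)
  from this[of _ 0 c] this[of _ _ 0] show ?thesis
    unfolding smooth_on_interval_def
    by (intro exI[of _ "\<lambda>k s. a *\<^sub>R D k s + (if k = 0 then c else 0)"]) (auto simp: D(1)[symmetric])
qed

text \<open>The subspace is the orthogonal complement of its orthogonal complement, so membership is
  expressed by linear equations, which can be differentiated.\<close>

lemma derivative_in_direction:
  fixes h :: "real \<Rightarrow> 'a::euclidean_space"
  assumes "subspace W" "\<And>x. x \<in> S \<Longrightarrow> h x - p \<in> W" "s \<in> S"
    and h: "(h has_vector_derivative d) (at s within S)"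
  shows "d \<in> W"
proof -
  have "w \<bullet> d = 0" if "w \<in> W\<^sup>\<bottom>" for w
  proof (rule derivative_unique[OF assms(3)])
    show "((\<lambda>x. w \<bullet> (h x - p)) has_vector_derivative w \<bullet> d) (at s within S)"
      using bounded_linear.has_vector_derivative[OF bounded_linear_inner_right h, of w]
      by (simp add: inner_diff_right has_vector_derivative_diff_const)
    show "((\<lambda>x. 0) has_vector_derivative 0) (at s within S)"
      by simp
    show "w \<bullet> (h x - p) = 0" if "x \<in> S" for x
      using assms(2)[OF that] \<open>w \<in> W\<^sup>\<bottom>\<close> by (auto simp: orthogonal_comp_def orthogonal_def inner_commute)
  qed
  then have "d \<in> W\<^sup>\<bottom>\<^sup>\<bottom>"
    by (simp add: orthogonal_comp_def orthogonal_def inner_commute)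
  then show ?thesis
    using orthogonal_comp_self[OF assms(1)] by simp
qed

end

section \<open>Geometry of meridian surfaces\<close>

text \<open>The normal \<open>n\<close> is fixed as part of the data. Passing to the other choice -n
  changes the sign of \<kappa>, and the conditions that \<kappa> be 0, or be constantly 1 or
  constantly -1, are symmetric under this change.\<close>

locale meridian = I: nondegenerate_interval I + J: nondegenerate_interval J
  for I J :: "real set" +
  fixes f g :: "real \<Rightarrow> real" and l n :: "real \<Rightarrow> real^4"
  assumes smooth_f: "smooth_on_interval I f" and smooth_g: "smooth_on_interval I g"
    and f_pos: "u \<in> I \<Longrightarrow> f u > 0"
    and arc_length: "u \<in> I \<Longrightarrow> (deriv_on I f u)\<^sup>2 + (deriv_on I g u)\<^sup>2 = 1"
    and smooth_l: "smooth_on_interval J l"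
    and l_de_sitter: "v \<in> J \<Longrightarrow> l v \<in> de_sitter"
    and l_unit_speed: "v \<in> J \<Longrightarrow> mink (deriv_on J l v) (deriv_on J l v) = 1"
    and smooth_n: "smooth_on_interval J n"
    and n_mink3: "v \<in> J \<Longrightarrow> n v \<in> mink3"
    and n_unit: "v \<in> J \<Longrightarrow> mink (n v) (n v) = -1"
    and n_l: "v \<in> J \<Longrightarrow> mink (n v) (l v) = 0"
    and n_t: "v \<in> J \<Longrightarrow> mink (n v) (deriv_on J l v) = 0"
begin

abbreviation "f1 \<equiv> deriv_on I f"
abbreviation "f2 \<equiv> deriv_on I f1"
abbreviation "f3 \<equiv> deriv_on I f2"
abbreviation "g1 \<equiv> deriv_on I g"
abbreviation "g2 \<equiv> deriv_on I g1"
abbreviation "g3 \<equiv> deriv_on I g2"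
abbreviation "e \<equiv> frame_vec 1"
abbreviation "t \<equiv> deriv_on J l"
abbreviation "\<kappa> \<equiv> spherical_curvature J l n"
abbreviation "\<kappa>1 \<equiv> deriv_on J \<kappa>"
abbreviation "z \<equiv> meridian_surface f g l"
abbreviation "G \<equiv> gauss_map I J z frame_x (frame_y f)"

lemmas smooth_derivs =
  smooth_f smooth_f[THEN I.smooth_deriv_on] smooth_f[THEN I.smooth_deriv_on, THEN I.smooth_deriv_on]
  smooth_g smooth_g[THEN I.smooth_deriv_on] smooth_g[THEN I.smooth_deriv_on, THEN I.smooth_deriv_on]

lemmas fg_derivs = smooth_derivs[THEN I.smooth_imp_real_derivative]

lemmas l_deriv = J.smooth_imp_derivative[OF smooth_l]
lemmas n_deriv = J.smooth_imp_derivative[OF smooth_n]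

lemma f_nonzero: "u \<in> I \<Longrightarrow> f u \<noteq> 0"
  using f_pos by force

section \<open>The moving frame along the curve\<close>

lemma mink_derivative_zero:
  assumes "\<And>v. v \<in> J \<Longrightarrow> mink (a v) (b v) = c" "v \<in> J"
    and "(a has_vector_derivative a') (at v within J)" "(b has_vector_derivative b') (at v within J)"
  shows "mink (a v) b' + mink a' (b v) = 0"
  by (rule J.derivative_unique[OF assms(2), of "\<lambda>_. c" 0 "\<lambda>v. mink (a v) (b v)"])
     (auto intro: assms has_vector_derivative_mink)

text \<open>Differentiating \<open>mink (l v) (l v) = 1\<close> and \<open>mink (l v) e = 0\<close>
  makes \<open>t\<close> orthogonal to \<open>l\<close> and \<open>e\<close>; the other products
  come from the hypotheses, membership in \<open>mink3\<close> and symmetry.\<close>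

lemma frame_products:
  assumes "v \<in> J"
  shows "mink (l v) (l v) = 1" "mink (l v) (t v) = 0" "mink (l v) (n v) = 0" "mink (l v) e = 0"
    "mink (t v) (l v) = 0" "mink (t v) (t v) = 1" "mink (t v) (n v) = 0" "mink (t v) e = 0"
    "mink (n v) (l v) = 0" "mink (n v) (t v) = 0" "mink (n v) (n v) = -1" "mink (n v) e = 0"
    "mink e (l v) = 0" "mink e (t v) = 0" "mink e (n v) = 0"
proof -
  have ll: "mink (l v) (l v) = 1" and le: "mink (l v) e = 0" if "v \<in> J" for v
    using l_de_sitter[OF that] mink3_component by (auto simp: de_sitter_def)
  show lt: "mink (l v) (t v) = 0"
    using mink_derivative_zero[OF ll assms l_deriv l_deriv] assms by (simp add: mink_commute)
  show te: "mink (t v) e = 0"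
    using mink_derivative_zero[OF le assms l_deriv has_vector_derivative_const] assms
    by (simp add: mink_simps)
  show "mink (l v) (l v) = 1" "mink (l v) e = 0" "mink (t v) (t v) = 1" "mink (n v) (n v) = -1"
    using ll le l_unit_speed n_unit assms by simp_all
  show "mink (n v) (l v) = 0" "mink (n v) (t v) = 0" "mink (n v) e = 0"
    using n_l n_t n_mink3 mink3_component assms by simp_all
  then show "mink (l v) (n v) = 0" "mink (t v) (n v) = 0" "mink e (n v) = 0"
    by (simp_all add: mink_commute)
  show "mink (t v) (l v) = 0" "mink e (l v) = 0" "mink e (t v) = 0"
    using lt te le[OF assms] by (simp_all add: mink_commute)
qed

lemma frame_expansion:
  assumes "v \<in> J"
  shows "w = mink w e *\<^sub>R e + mink w (l v) *\<^sub>R l v + mink w (t v) *\<^sub>R t v - mink w (n v) *\<^sub>R n v"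
  by (rule pseudo_orthonormal_expansion) (use frame_products[OF assms] mink_frame_vec_1 in simp_all)

text \<open>Three coordinates of t' come from differentiating the constant products of
  \<open>t\<close> with \<open>e\<close>, \<open>t\<close> and \<open>l\<close>; the fourth is
  \<kappa> by definition, and it enters with a minus sign because \<open>n\<close> is
  timelike.\<close>

lemma t_deriv:
  assumes "v \<in> J"
  shows "(t has_vector_derivative - \<kappa> v *\<^sub>R n v - l v) (at v within J)"
proof -
  have t: "(t has_vector_derivative deriv_on J t v) (at v within J)" if "v \<in> J" for v
    using J.smooth_imp_derivative[OF J.smooth_deriv_on[OF smooth_l] that] .
  have "mink (deriv_on J t v) e = 0"
    using mink_derivative_zero[OF frame_products(8) assms t has_vector_derivative_const] assms
    by (simp add: mink_simps)
  moreover have "mink (deriv_on J t v) (t v) = 0"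
    using mink_derivative_zero[OF frame_products(6) assms t t] assms by (simp add: mink_commute)
  moreover have "mink (deriv_on J t v) (l v) = - 1"
    using mink_derivative_zero[OF frame_products(5) assms t l_deriv] assms frame_products[OF assms]
    by simp
  moreover have "mink (deriv_on J t v) (n v) = \<kappa> v"
    by (simp add: spherical_curvature_def)
  ultimately have "deriv_on J t v = - \<kappa> v *\<^sub>R n v - l v"
    using frame_expansion[OF assms, of "deriv_on J t v"] by simp
  then show ?thesis using t[OF assms] by simp
qed

lemma n_deriv_frenet:
  assumes "v \<in> J"
  shows "(n has_vector_derivative - \<kappa> v *\<^sub>R t v) (at v within J)"
proof -
  note n' = n_deriv[OF assms]
  have "mink (deriv_on J n v) e = 0"
    using mink_derivative_zero[OF frame_products(12) assms n' has_vector_derivative_const]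
    by (simp add: mink_simps)
  moreover have "mink (deriv_on J n v) (n v) = 0"
    using mink_derivative_zero[OF frame_products(11) assms n' n'] by (simp add: mink_commute)
  moreover have "mink (deriv_on J n v) (l v) = 0"
    using mink_derivative_zero[OF frame_products(9) assms n' l_deriv] assms frame_products[OF assms]
    by simp
  moreover have "mink (deriv_on J n v) (t v) = - \<kappa> v"
    using mink_derivative_zero[OF frame_products(10) assms n' t_deriv] assms frame_products[OF assms]
    by (simp add: mink_simps)
  ultimately have "deriv_on J n v = - \<kappa> v *\<^sub>R t v"
    using frame_expansion[OF assms, of "deriv_on J n v"] by simp
  then show ?thesis using n' by simp
qed

lemma curvature_deriv:
  assumes "v \<in> J"
  shows "(\<kappa> has_real_derivative \<kappa>1 v) (at v within J)"
proof -
  have "(\<kappa> has_vector_derivative (mink (deriv_on J t v) (deriv_on J n v)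
      + mink (deriv_on J (deriv_on J t) v) (n v))) (at v within J)"
    unfolding spherical_curvature_def
    using J.smooth_imp_derivative[OF J.smooth_deriv_on[OF J.smooth_deriv_on[OF smooth_l]] assms]
      n_deriv[OF assms]
    by (rule has_vector_derivative_mink)
  then show ?thesis
    using J.deriv_on_eqI[OF assms] by (metis has_real_derivative_iff_has_vector_derivative)
qed

lemmas frame_derivs = l_deriv t_deriv n_deriv_frenet

lemma arc_length_deriv: "u \<in> I \<Longrightarrow> f1 u * f2 u + g1 u * g2 u = 0"
proof -
  assume u: "u \<in> I"
  have "2 * f1 u * f2 u + 2 * g1 u * g2 u = 0"
    by (rule I.derivative_unique[OF u, of "\<lambda>_. 1" 0 "\<lambda>u. (f1 u)\<^sup>2 + (g1 u)\<^sup>2"])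
       (auto simp: u arc_length has_real_derivative_iff_has_vector_derivative[symmetric]
         intro!: derivative_eq_intros fg_derivs)
  then show ?thesis by simp
qed

text \<open>The two squares show that \<open>f1 u * f3 u + g1 u * g3 u\<close> is never positive,
  which is the source of definiteness when \<kappa> = 0.\<close>

lemma arc_length_deriv2:
  "u \<in> I \<Longrightarrow> (f2 u)\<^sup>2 + f1 u * f3 u + (g2 u)\<^sup>2 + g1 u * g3 u = 0"
  by (rule I.derivative_unique[of _ "\<lambda>_. 0" 0 "\<lambda>u. f1 u * f2 u + g1 u * g2 u"])
     (auto simp: arc_length_deriv has_real_derivative_iff_has_vector_derivative[symmetric]
       power2_eq_square intro!: derivative_eq_intros fg_derivs)

section \<open>Metric and Levi-Civita connection of the surface\<close>

lemma partial1_eqI: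
  assumes "u \<in> I" "((\<lambda>s. \<Psi> s) has_vector_derivative d) (at u within I)"
    and "\<And>s. s \<in> I \<Longrightarrow> \<Phi> s v = \<Psi> s"
  shows "partial_deriv I J 1 \<Phi> u v = d"
  using I.deriv_on_eqI[OF assms] by (simp add: partial_deriv_def)

lemma partial2_eqI:
  assumes "v \<in> J" "((\<lambda>s. \<Psi> s) has_vector_derivative d) (at v within J)"
    and "\<And>s. s \<in> J \<Longrightarrow> \<Phi> u s = \<Psi> s"
  shows "partial_deriv I J 2 \<Phi> u v = d"
  using J.deriv_on_eqI[OF assms] by (simp add: partial_deriv_def)

lemma flat_deriv_frame_x: "flat_deriv I J frame_x \<Phi> u v = partial_deriv I J 1 \<Phi> u v"
  by (simp add: flat_deriv_def frame_x_def coord_field_def sum_2 axis_def)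

lemma flat_deriv_frame_y: "flat_deriv I J (frame_y f) \<Phi> u v = (1 / f u) *\<^sub>R partial_deriv I J 2 \<Phi> u v"
  by (simp add: flat_deriv_def frame_y_def coord_field_def sum_2 axis_def)

lemma flat_deriv_coord_field: "flat_deriv I J (coord_field i) \<Phi> u v = partial_deriv I J i \<Phi> u v"
  using exhaust_2[of i] by (auto simp: flat_deriv_def coord_field_def sum_2 axis_def)

lemma partial1_z: "u \<in> I \<Longrightarrow> partial_deriv I J 1 z u v = f1 u *\<^sub>R l v + g1 u *\<^sub>R e"
  by (rule partial1_eqI) (auto simp: meridian_surface_def intro!: derivative_eq_intros fg_derivs)

lemma partial2_z: "v \<in> J \<Longrightarrow> partial_deriv I J 2 z u v = f u *\<^sub>R t v"
  by (rule partial2_eqI) (auto simp: meridian_surface_def intro!: derivative_eq_intros l_deriv)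

lemma first_fundamental_form_z:
  assumes "u \<in> I" "v \<in> J"
  shows "first_fundamental_form I J z u v $ 1 $ 1 = 1"
    "first_fundamental_form I J z u v $ 1 $ 2 = 0"
    "first_fundamental_form I J z u v $ 2 $ 1 = 0"
    "first_fundamental_form I J z u v $ 2 $ 2 = (f u)\<^sup>2"
  using arc_length[OF assms(1)] frame_products[OF assms(2)] mink_frame_vec_1
  by (simp_all add: first_fundamental_form_def partial1_z partial2_z assms mink_simps
      power2_eq_square)

lemma inverse_first_fundamental_form_z:
  assumes "u \<in> I" "v \<in> J"
  shows "matrix_inv (first_fundamental_form I J z u v)
    = (\<chi> i j. if i = j then if i = 1 then 1 else 1 / (f u)\<^sup>2 else 0)"
  by (rule matrix_inv_eqI)
     (auto simp: matrix_matrix_mult_def mat_def vec_eq_iff sum_2 forall_2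
       first_fundamental_form_z[OF assms] f_nonzero[OF assms(1)])

lemma partial1_metric:
  assumes "u \<in> I" "v \<in> J"
  shows "partial_deriv I J 1 (\<lambda>u v. first_fundamental_form I J z u v $ 1 $ 1) u v = 0"
    "partial_deriv I J 1 (\<lambda>u v. first_fundamental_form I J z u v $ 1 $ 2) u v = 0"
    "partial_deriv I J 1 (\<lambda>u v. first_fundamental_form I J z u v $ 2 $ 1) u v = 0"
    "partial_deriv I J 1 (\<lambda>u v. first_fundamental_form I J z u v $ 2 $ 2) u v = 2 * f u * f1 u"
proof -
  show "partial_deriv I J 1 (\<lambda>u v. first_fundamental_form I J z u v $ 2 $ 2) u v = 2 * f u * f1 u"
    by (rule partial1_eqI[where \<Psi> = "\<lambda>s. (f s)\<^sup>2"])
       (auto simp: assms first_fundamental_form_z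
         has_real_derivative_iff_has_vector_derivative[symmetric]
         intro!: derivative_eq_intros fg_derivs)
qed (rule partial1_eqI[OF _ has_vector_derivative_const],
     auto simp: assms first_fundamental_form_z)+

lemma partial2_metric:
  assumes "u \<in> I" "v \<in> J"
  shows "partial_deriv I J 2 (\<lambda>u v. first_fundamental_form I J z u v $ i $ j) u v = 0"
  using exhaust_2[of i] exhaust_2[of j]
  by (elim disjE)
     (auto intro!: partial2_eqI[OF _ has_vector_derivative_const] simp: assms first_fundamental_form_z)

text \<open>Symbols with equal lower indices suffice: the Laplacian differentiates each frame field
  along itself, and in the mean curvature the diagonal metric leaves only the diagonal
  terms.\<close>

lemma christoffel_z:
  assumes "u \<in> I" "v \<in> J"
  shows "christoffel I J z k 1 1 u v = 0"
    "christoffel I J z 1 2 2 u v = - f u * f1 u"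
    "christoffel I J z 2 2 2 u v = 0"
  using exhaust_2[of k]
  by (auto simp: christoffel_def Let_def sum_2 inverse_first_fundamental_form_z[OF assms]
      partial1_metric[OF assms] partial2_metric[OF assms])

lemma levi_civita_frame_x:
  assumes "u \<in> I" "v \<in> J"
  shows "levi_civita I J z frame_x frame_x u v = 0"
proof -
  have "partial_deriv I J 1 (\<lambda>u v. c) u v = (0::real)" for c
    by (rule partial1_eqI[OF assms(1) has_vector_derivative_const]) simp
  then show ?thesis
    by (simp add: levi_civita_def frame_x_def coord_field_def vec_eq_iff sum_2 axis_def
        christoffel_z[OF assms])
qed

text \<open>Up to sign, f'/f is the geodesic curvature of the curves of constant u; it produces the
  terms with a single factor 1/f in the Laplacian.\<close>

lemma levi_civita_frame_y:
  assumes "u \<in> I" "v \<in> J"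
  shows "levi_civita I J z (frame_y f) (frame_y f) u v = - (f1 u / f u) *\<^sub>R coord_field 1 u v"
proof -
  have "partial_deriv I J 2 (\<lambda>u v. c u) u v = (0::real)" for c
    by (rule partial2_eqI[OF assms(2) has_vector_derivative_const]) simp
  then show ?thesis
    using f_nonzero[OF assms(1)]
    by (simp add: levi_civita_def frame_y_def coord_field_def vec_eq_iff forall_2 sum_2 axis_def
        christoffel_z[OF assms])
qed

lemma levi_civita_coord_field:
  assumes "u \<in> I" "v \<in> J"
  shows "levi_civita I J z (coord_field 1) (coord_field 1) u v = 0"
    "levi_civita I J z (coord_field 2) (coord_field 2) u v = - (f u * f1 u) *\<^sub>R coord_field 1 u v"
proof -
  have "partial_deriv I J 1 (\<lambda>u v. c) u v = (0::real)"
    "partial_deriv I J 2 (\<lambda>u v. c) u v = (0::real)" for c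
    by (rule partial1_eqI[OF assms(1) has_vector_derivative_const]
        partial2_eqI[OF assms(2) has_vector_derivative_const], simp)+
  then show "levi_civita I J z (coord_field 1) (coord_field 1) u v = 0"
    "levi_civita I J z (coord_field 2) (coord_field 2) u v = - (f u * f1 u) *\<^sub>R coord_field 1 u v"
    by (simp_all add: levi_civita_def coord_field_def vec_eq_iff forall_2 sum_2 axis_def
        christoffel_z[OF assms])
qed

section \<open>The Gauss map and its Laplacian\<close>

lemma gauss_map_z:
  assumes "u \<in> I" "v \<in> J"
  shows "G u v = f1 u *\<^sub>R wedge (l v) (t v) + g1 u *\<^sub>R wedge e (t v)"
  \<comment> \<open>The factor 1/f in \<open>frame_y\<close> cancels the length f of the second
    coordinate vector, so G depends on the meridian only through f' and g'.\<close>
  using f_nonzero[OF assms(1)]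
  by (simp add: gauss_map_def flat_deriv_frame_x flat_deriv_frame_y partial1_z partial2_z assms
      wedge_simps)

lemma partial1_gauss_map:
  assumes "u \<in> I" "v \<in> J"
  shows "partial_deriv I J 1 G u v = f2 u *\<^sub>R wedge (l v) (t v) + g2 u *\<^sub>R wedge e (t v)"
  by (rule partial1_eqI[where \<Psi> = "\<lambda>u. f1 u *\<^sub>R wedge (l v) (t v) + g1 u *\<^sub>R wedge e (t v)"])
     (auto simp: assms gauss_map_z intro!: derivative_eq_intros fg_derivs)

lemma partial2_gauss_map:
  assumes "u \<in> I" "v \<in> J"
  shows "partial_deriv I J 2 G u v =
    - (f1 u * \<kappa> v) *\<^sub>R wedge (l v) (n v) - (g1 u * \<kappa> v) *\<^sub>R wedge e (n v) - g1 u *\<^sub>R wedge e (l v)"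
  by (rule partial2_eqI[where \<Psi> = "\<lambda>v. f1 u *\<^sub>R wedge (l v) (t v) + g1 u *\<^sub>R wedge e (t v)"])
     (auto simp: assms gauss_map_z wedge_simps wedge_self algebra_simps intro!: derivative_eq_intros frame_derivs)

text \<open>The sign is reversed so that second derivatives appear with coefficient 1. In the v
  direction, \<open>wedge e (l v)\<close> differentiates to \<open>wedge e (t v)\<close> and
  \<open>wedge e (n v)\<close> to \<open>- \<kappa> v *\<^sub>R wedge e (t v)\<close>; with the
  coefficients of the first derivative these give -1 and \<kappa>^2.\<close>

lemma laplacian_gauss_map:
  assumes u: "u \<in> I" and v: "v \<in> J"
  shows "- laplacian I J z frame_x (frame_y f) G u v =
      (f3 u + f1 u * (\<kappa> v)\<^sup>2 / (f u)\<^sup>2 + f1 u * f2 u / f u) *\<^sub>R wedge (l v) (t v)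
    + (g3 u + g1 u * ((\<kappa> v)\<^sup>2 - 1) / (f u)\<^sup>2 + f1 u * g2 u / f u) *\<^sub>R wedge e (t v)
    + (- f1 u * \<kappa>1 v / (f u)\<^sup>2) *\<^sub>R wedge (l v) (n v)
    + (- g1 u * \<kappa>1 v / (f u)\<^sup>2) *\<^sub>R wedge e (n v)
    + (- f1 u * \<kappa> v / (f u)\<^sup>2) *\<^sub>R wedge (t v) (n v)"
proof -
  have uu: "partial_deriv I J 1 (\<lambda>u v. partial_deriv I J 1 G u v) u v
      = f3 u *\<^sub>R wedge (l v) (t v) + g3 u *\<^sub>R wedge e (t v)"
    by (rule partial1_eqI[where \<Psi> = "\<lambda>u. f2 u *\<^sub>R wedge (l v) (t v) + g2 u *\<^sub>R wedge e (t v)"])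
       (auto simp: assms partial1_gauss_map intro!: derivative_eq_intros fg_derivs)
  have vv: "partial_deriv I J 2 (\<lambda>u v. (1 / f u) *\<^sub>R partial_deriv I J 2 G u v) u v
      = (1 / f u) *\<^sub>R (- (f1 u * \<kappa>1 v) *\<^sub>R wedge (l v) (n v) - (f1 u * \<kappa> v) *\<^sub>R wedge (t v) (n v)
        + (f1 u * (\<kappa> v)\<^sup>2) *\<^sub>R wedge (l v) (t v)
        - (g1 u * \<kappa>1 v) *\<^sub>R wedge e (n v) + (g1 u * ((\<kappa> v)\<^sup>2 - 1)) *\<^sub>R wedge e (t v))"
  proof (rule partial2_eqI[OF v])
    show "((\<lambda>v. (1 / f u) *\<^sub>R (- (f1 u * \<kappa> v) *\<^sub>R wedge (l v) (n v)
        - (g1 u * \<kappa> v) *\<^sub>R wedge e (n v) - g1 u *\<^sub>R wedge e (l v))) has_vector_derivative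
      (1 / f u) *\<^sub>R (- (f1 u * \<kappa>1 v) *\<^sub>R wedge (l v) (n v) - (f1 u * \<kappa> v) *\<^sub>R wedge (t v) (n v)
        + (f1 u * (\<kappa> v)\<^sup>2) *\<^sub>R wedge (l v) (t v)
        - (g1 u * \<kappa>1 v) *\<^sub>R wedge e (n v) + (g1 u * ((\<kappa> v)\<^sup>2 - 1)) *\<^sub>R wedge e (t v)))
      (at v within J)"
      by (rule derivative_eq_intros frame_derivs curvature_deriv v refl)+
         (simp add: wedge_simps algebra_simps power2_eq_square)
  qed (simp add: partial2_gauss_map u)
  have xx: "flat_deriv I J (levi_civita I J z frame_x frame_x) G u v = 0"
    by (simp add: flat_deriv_def levi_civita_frame_x assms)
  have yy: "flat_deriv I J (levi_civita I J z (frame_y f) (frame_y f)) G u v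
      = - (f1 u / f u) *\<^sub>R partial_deriv I J 1 G u v"
    by (simp add: flat_deriv_def levi_civita_frame_y assms sum_2 coord_field_def axis_def)
  show ?thesis
    unfolding laplacian_def xx yy
    by (simp add: flat_deriv_frame_x[abs_def] flat_deriv_frame_y[abs_def] uu vv
        partial1_gauss_map assms algebra_simps power2_eq_square diff_divide_distrib)
qed

section \<open>Harmonic Gauss map\<close>

lemma harmonic_coefficients:
  assumes "harmonic_gauss_map I J f g l" and u: "u \<in> I" and v: "v \<in> J"
  shows "f3 u + f1 u * (\<kappa> v)\<^sup>2 / (f u)\<^sup>2 + f1 u * f2 u / f u = 0"
    "g3 u + g1 u * ((\<kappa> v)\<^sup>2 - 1) / (f u)\<^sup>2 + f1 u * g2 u / f u = 0"
    "f1 u * \<kappa>1 v = 0" "g1 u * \<kappa>1 v = 0" "f1 u * \<kappa> v = 0"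
proof -
  have "laplacian I J z frame_x (frame_y f) G u v = 0"
    using assms by (simp add: harmonic_gauss_map_def Let_def)
  \<comment> \<open>The test bivector \<open>C\<close> stays free. The five frame bivectors are
    mutually orthogonal and non-null, so inserting each of them in turn extracts its own
    coefficient.\<close>
  then have 0:
    "0 = (f3 u + f1 u * (\<kappa> v)\<^sup>2 / (f u)\<^sup>2 + f1 u * f2 u / f u) *
        wedge_inner (wedge (l v) (t v)) C
      + (g3 u + g1 u * ((\<kappa> v)\<^sup>2 - 1) / (f u)\<^sup>2 + f1 u * g2 u / f u) *
        wedge_inner (wedge e (t v)) C
      + (- f1 u * \<kappa>1 v / (f u)\<^sup>2) * wedge_inner (wedge (l v) (n v)) C
      + (- g1 u * \<kappa>1 v / (f u)\<^sup>2) * wedge_inner (wedge e (n v)) C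
      + (- f1 u * \<kappa> v / (f u)\<^sup>2) * wedge_inner (wedge (t v) (n v)) C" for C
    using arg_cong[OF laplacian_gauss_map[OF u v], of "\<lambda>A. wedge_inner A C"]
    by (simp only: minus_zero wedge_inner_add wedge_inner_scaleR wedge_inner_zero)
  note products = wedge_inner_decomposable frame_products[OF v] mink_frame_vec_1
  show "f3 u + f1 u * (\<kappa> v)\<^sup>2 / (f u)\<^sup>2 + f1 u * f2 u / f u = 0"
    using 0[of "wedge (l v) (t v)"] by (simp add: products)
  show "g3 u + g1 u * ((\<kappa> v)\<^sup>2 - 1) / (f u)\<^sup>2 + f1 u * g2 u / f u = 0"
    using 0[of "wedge e (t v)"] by (simp add: products)
  show "f1 u * \<kappa>1 v = 0"
    using 0[of "wedge (l v) (n v)"] f_nonzero[OF u] by (simp add: products)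
  show "g1 u * \<kappa>1 v = 0"
    using 0[of "wedge e (n v)"] f_nonzero[OF u] by (simp add: products)
  show "f1 u * \<kappa> v = 0"
    using 0[of "wedge (t v) (n v)"] f_nonzero[OF u] by (simp add: products)
qed

lemma harmonicI:
  assumes "\<And>u v. u \<in> I \<Longrightarrow> v \<in> J \<Longrightarrow>
      f3 u + f1 u * (\<kappa> v)\<^sup>2 / (f u)\<^sup>2 + f1 u * f2 u / f u = 0 \<and>
      g3 u + g1 u * ((\<kappa> v)\<^sup>2 - 1) / (f u)\<^sup>2 + f1 u * g2 u / f u = 0 \<and>
      f1 u * \<kappa>1 v = 0 \<and> g1 u * \<kappa>1 v = 0 \<and> f1 u * \<kappa> v = 0"
  shows "harmonic_gauss_map I J f g l"
  unfolding harmonic_gauss_map_def Let_def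
proof (intro ballI)
  fix u v assume "u \<in> I" "v \<in> J"
  then show "laplacian I J z frame_x (frame_y f) G u v = 0"
    using laplacian_gauss_map[of u v] assms[of u v] by simp
qed

section \<open>Both cases give a harmonic Gauss map\<close>

lemma derivative_zero_if_constant:
  "(\<And>u. u \<in> I \<Longrightarrow> h u = c) \<Longrightarrow> u \<in> I \<Longrightarrow> deriv_on I h u = (0::real)"
  by (rule I.deriv_on_eqI[OF _ has_vector_derivative_const])

lemma curvature_derivative_zero_if_constant:
  "(\<And>v. v \<in> J \<Longrightarrow> \<kappa> v = c) \<Longrightarrow> v \<in> J \<Longrightarrow> \<kappa>1 v = 0"
  by (rule J.deriv_on_eqI[OF _ has_vector_derivative_const])

text \<open>With f' = 0, arc length gives g'^2 = 1, so g' can be cancelled in g' g'' = 0. The roles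
  of f and g are exchanged in the lemma that follows.\<close>

lemma second_deriv_g_zero:
  assumes "\<And>u. u \<in> I \<Longrightarrow> f1 u = 0" "u \<in> I"
  shows "g2 u = 0" "g3 u = 0"
proof -
  have *: "g2 u = 0" if "u \<in> I" for u
    using arc_length_deriv[OF that] arc_length[OF that] assms(1)[OF that] by auto
  show "g2 u = 0" "g3 u = 0"
    using derivative_zero_if_constant[of g2 0] assms(2) * by auto
qed

lemma second_deriv_f_zero:
  assumes "\<And>u. u \<in> I \<Longrightarrow> g1 u = 0" "u \<in> I"
  shows "f2 u = 0" "f3 u = 0"
proof -
  have *: "f2 u = 0" if "u \<in> I" for u
    using arc_length_deriv[OF that] arc_length[OF that] assms(1)[OF that] by auto
  show "f2 u = 0" "f3 u = 0"
    using derivative_zero_if_constant[of f2 0] assms(2) * by auto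
qed

lemma planar_imp_harmonic:
  assumes "\<And>v. v \<in> J \<Longrightarrow> \<kappa> v = 0" "\<And>u. u \<in> I \<Longrightarrow> g1 u = 0"
  shows "harmonic_gauss_map I J f g l"
  using assms second_deriv_f_zero[OF assms(2)] derivative_zero_if_constant[of g1 0]
    derivative_zero_if_constant[of g2 0] curvature_derivative_zero_if_constant[of 0]
  by (intro harmonicI) auto

lemma cylindrical_imp_harmonic:
  assumes "(\<forall>v\<in>J. \<kappa> v = 1) \<or> (\<forall>v\<in>J. \<kappa> v = -1)" and "\<And>u. u \<in> I \<Longrightarrow> f1 u = 0"
  shows "harmonic_gauss_map I J f g l"
proof (rule harmonicI)
  fix u v assume uv: "u \<in> I" "v \<in> J"
  have "\<kappa>1 v = 0"
    using assms(1) curvature_derivative_zero_if_constant uv by blast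
  moreover have "(\<kappa> v)\<^sup>2 = 1"
    using assms(1) uv by auto
  moreover have "f2 u = 0" "f3 u = 0"
    using derivative_zero_if_constant[of f1 0] derivative_zero_if_constant[of f2 0] assms(2) uv
    by auto
  ultimately show "f3 u + f1 u * (\<kappa> v)\<^sup>2 / (f u)\<^sup>2 + f1 u * f2 u / f u = 0 \<and>
      g3 u + g1 u * ((\<kappa> v)\<^sup>2 - 1) / (f u)\<^sup>2 + f1 u * g2 u / f u = 0 \<and>
      f1 u * \<kappa>1 v = 0 \<and> g1 u * \<kappa>1 v = 0 \<and> f1 u * \<kappa> v = 0"
    using assms(2) second_deriv_g_zero[OF assms(2)] uv by auto
qed

section \<open>Planar surfaces: \<kappa> = 0 and g' = 0\<close>

lemma independent_pair:
  assumes "mink a a > 0" "mink b b > 0" "mink a b = 0"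
  shows "a \<noteq> b" "independent {a, b}"
proof -
  show "a \<noteq> b" using assms by auto
  \<comment> \<open>If a = r b, pairing with \<open>b\<close> gives r = 0, and then a = 0
    contradicts the positive square of \<open>a\<close>.\<close>
  have "a \<notin> span {b}"
    using assms by (auto simp: span_singleton mink_simps)
  moreover have "b \<noteq> 0"
    using assms by (auto simp: mink_simps)
  ultimately show "independent {a, b}"
    by (simp add: independent_insert)
qed

text \<open>By the Frenet equation, \<kappa> = 0 makes \<open>n\<close> constant. Hence every
  \<open>l v\<close> is orthogonal to \<open>e\<close> and to the same \<open>n v0\<close>, which
  confines it to the span of \<open>l v0\<close> and \<open>t v0\<close>; constant g supplies the
  translation along \<open>e\<close>.\<close>

lemma planar_imp_part_of_plane:
  assumes \<kappa>: "\<And>v. v \<in> J \<Longrightarrow> \<kappa> v = 0" and g1: "\<And>u. u \<in> I \<Longrightarrow> g1 u = 0"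
  shows "part_of_plane I J z"
proof -
  obtain v0 where v0: "v0 \<in> J" using J.nonempty by blast
  obtain b where b: "\<And>u. u \<in> I \<Longrightarrow> g u = b"
  proof (rule I.constant_if_derivative_zero[of g])
    show "(g has_vector_derivative 0) (at u within I)" if "u \<in> I" for u
      using I.smooth_imp_derivative[OF smooth_g that] g1[OF that] by simp
  qed (use that in blast)
  obtain c where c: "\<And>v. v \<in> J \<Longrightarrow> n v = c"
  proof (rule J.constant_if_derivative_zero[of n])
    show "(n has_vector_derivative 0) (at v within J)" if "v \<in> J" for v
      using n_deriv_frenet[OF that] \<kappa>[OF that] by simp
  qed (use that in blast)
  define W where "W = span {l v0, t v0}"
  have "l v \<in> W" if "v \<in> J" for v
  proof -
    have "mink (l v) (n v0) = 0"
      using frame_products(3)[OF that] c[OF that] c[OF v0] by simp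
    then have "l v = mink (l v) (l v0) *\<^sub>R l v0 + mink (l v) (t v0) *\<^sub>R t v0"
      using frame_expansion[OF v0, of "l v"] frame_products(4)[OF that] by simp
    moreover have "r *\<^sub>R l v0 + s *\<^sub>R t v0 \<in> W" for r s
      unfolding W_def by (intro span_add span_scale span_base) simp_all
    ultimately show ?thesis by metis
  qed
  then have "z u v \<in> (+) (b *\<^sub>R e) ` W" if "u \<in> I" "v \<in> J" for u v
    using that b[OF that(1)] unfolding meridian_surface_def W_def
    by (intro image_eqI[of _ _ "f u *\<^sub>R l v"]) (auto intro: span_scale)
  moreover have "dim W = 2"
    using independent_pair[of "l v0" "t v0"] frame_products[OF v0]
    by (simp add: W_def dim_eq_card_independent)
  then have "aff_dim ((+) (b *\<^sub>R e) ` W) = 2"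
    by (simp add: aff_dim_translation_eq aff_dim_subspace W_def)
  moreover have "affine ((+) (b *\<^sub>R e) ` W)"
    by (simp add: W_def affine_translation[symmetric] subspace_imp_affine)
  ultimately show ?thesis
    unfolding part_of_plane_def by blast
qed

lemma tangent_independent:
  assumes "u \<in> I" "v \<in> J"
  shows "independent {f1 u *\<^sub>R l v + g1 u *\<^sub>R e, t v}" "f1 u *\<^sub>R l v + g1 u *\<^sub>R e \<noteq> t v"
  using independent_pair[of "f1 u *\<^sub>R l v + g1 u *\<^sub>R e" "t v"] arc_length[OF assms(1)]
    frame_products[OF assms(2)]
  by (simp_all add: mink_simps mink_frame_vec_1 power2_eq_square)

text \<open>The two tangent directions already fill the direction space of the plane, so t', which
  also lies there, is tangent to the surface. A tangent vector has no \<open>n\<close> component,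
  which gives \<kappa> = 0.\<close>

lemma part_of_plane_imp_planar:
  assumes "part_of_plane I J z" and u: "u \<in> I" and v: "v \<in> J"
  shows "\<kappa> v = 0" "g1 u = 0"
proof -
  obtain P where P: "affine P" "aff_dim P = 2" "\<And>u v. u \<in> I \<Longrightarrow> v \<in> J \<Longrightarrow> z u v \<in> P"
    using assms unfolding part_of_plane_def by blast
  define p where "p = z u v"
  define W where "W = (\<lambda>x. x - p) ` P"
  have W: "subspace W"
    using P u v by (auto simp: W_def p_def intro!: affine_diffs_subspace_subtract)
  have "aff_dim W = 2"
    using P(2) by (simp add: W_def aff_dim_translation_eq_subtract)
  then have dim: "dim W = 2"
    by (simp add: aff_dim_subspace[OF W])
  have zW: "z u v - p \<in> W" if "u \<in> I" "v \<in> J" for u v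
    using P(3)[OF that] by (auto simp: W_def)
  have x: "f1 u *\<^sub>R l v + g1 u *\<^sub>R e \<in> W"
    by (rule I.derivative_in_direction[OF W zW[OF _ v] u])
       (auto simp: meridian_surface_def u intro!: derivative_eq_intros fg_derivs)
  \<comment> \<open>Stated for all parameters in \<open>J\<close>, with \<open>u\<close> fixed,
    because this membership is differentiated once more to reach t'.\<close>
  have tW: "t v \<in> W" if "v \<in> J" for v
  proof -
    have "f u *\<^sub>R t v \<in> W"
      by (rule J.derivative_in_direction[OF W zW[OF u] that])
         (auto simp: meridian_surface_def that intro!: derivative_eq_intros l_deriv)
    then have "(1 / f u) *\<^sub>R (f u *\<^sub>R t v) \<in> W"
      by (rule subspace_scale[OF W])
    then show ?thesis
      using f_nonzero[OF u] by simp
  qed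
  have "- \<kappa> v *\<^sub>R n v - l v \<in> W"
    by (rule J.derivative_in_direction[OF W _ v t_deriv[OF v], of 0]) (simp add: tW)
  moreover have "W \<subseteq> span {f1 u *\<^sub>R l v + g1 u *\<^sub>R e, t v}"
    using tangent_independent[OF u v] x tW[OF v] dim
    by (intro card_ge_dim_independent) auto
  ultimately have "- \<kappa> v *\<^sub>R n v - l v \<in> span {f1 u *\<^sub>R l v + g1 u *\<^sub>R e, t v}"
    by blast
  then obtain a where
      "- \<kappa> v *\<^sub>R n v - l v - a *\<^sub>R (f1 u *\<^sub>R l v + g1 u *\<^sub>R e) \<in> span {t v}"
    unfolding span_insert[of _ "{t v}"] by blast
  then obtain b where
      "- \<kappa> v *\<^sub>R n v - l v - a *\<^sub>R (f1 u *\<^sub>R l v + g1 u *\<^sub>R e) = b *\<^sub>R t v"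
    unfolding span_singleton by blast
  then have ab: "- \<kappa> v *\<^sub>R n v - l v = a *\<^sub>R (f1 u *\<^sub>R l v + g1 u *\<^sub>R e) + b *\<^sub>R t v"
    by (simp only: diff_eq_eq add.commute)
  \<comment> \<open>The \<open>l\<close> component of t' is -1, so \<open>a\<close> is nonzero, and
    the vanishing \<open>e\<close> component then forces g' = 0.\<close>
  have 1: "\<kappa> v = 0" and "a * f1 u = -1" and "a * g1 u = 0"
    using arg_cong[OF ab, of "\<lambda>w. mink w (n v)"] arg_cong[OF ab, of "\<lambda>w. mink w (l v)"]
      arg_cong[OF ab, of "\<lambda>w. mink w e"] frame_products[OF v]
    by (simp_all add: mink_simps mink_frame_vec_1)
  then show "\<kappa> v = 0" "g1 u = 0" by auto
qed

section \<open>Classification of the harmonic case\<close>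

lemma harmonic_imp_planar_or_cylindrical:
  assumes harmonic: "harmonic_gauss_map I J f g l"
  obtains "\<And>v. v \<in> J \<Longrightarrow> \<kappa> v = 0" "\<And>u. u \<in> I \<Longrightarrow> g1 u = 0"
  | c d where "c\<^sup>2 = 1" "d\<^sup>2 = 1" "\<And>v. v \<in> J \<Longrightarrow> \<kappa> v = c" "\<And>u. u \<in> I \<Longrightarrow> f1 u = 0"
    "\<And>u. u \<in> I \<Longrightarrow> g1 u = d"
proof (cases "\<forall>v\<in>J. \<kappa> v = 0")
  case True
  obtain v0 where v0: "v0 \<in> J" using J.nonempty by blast
  have "g1 u = 0" if u: "u \<in> I" for u
  proof -
    note coeffs = harmonic_coefficients(1,2)[OF harmonic u v0]
    have "f3 u * f u + f1 u * f2 u = 0" "g3 u * (f u)\<^sup>2 - g1 u + f u * f1 u * g2 u = 0"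
      using coeffs True v0 f_nonzero[OF u] by (simp_all add: field_simps power2_eq_square)
    \<comment> \<open>After clearing denominators the multipliers are f f' and g', since the first
      equation was cleared by f and the second by f^2. The first-order terms then collect into the
      derivative of the arc-length relation, which vanishes.\<close>
    then have "(f1 u * f3 u + g1 u * g3 u) * (f u)\<^sup>2 + f u * f1 u * (f1 u * f2 u + g1 u * g2 u)
        - (g1 u)\<^sup>2 = 0"
      by algebra
    moreover have "f1 u * f3 u + g1 u * g3 u = - ((f2 u)\<^sup>2 + (g2 u)\<^sup>2)"
      using arc_length_deriv2[OF u] by linarith
    ultimately have "((f2 u)\<^sup>2 + (g2 u)\<^sup>2) * (f u)\<^sup>2 + (g1 u)\<^sup>2 = 0"
      using arc_length_deriv[OF u] by (simp add: algebra_simps)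
    moreover have "((f2 u)\<^sup>2 + (g2 u)\<^sup>2) * (f u)\<^sup>2 \<ge> 0"
      by simp
    ultimately have "(g1 u)\<^sup>2 \<le> 0"
      by linarith
    then show ?thesis by simp
  qed
  then show ?thesis using True that(1) by blast
next
  case False
  then obtain v0 where v0: "v0 \<in> J" "\<kappa> v0 \<noteq> 0" by blast
  obtain u0 where u0: "u0 \<in> I" using I.nonempty by blast
  \<comment> \<open>A single \<open>v0\<close> serves every \<open>u\<close>, because the
    coefficient is a product of a function of u and a function of v.\<close>
  have f1: "f1 u = 0" if "u \<in> I" for u
    using harmonic_coefficients(5)[OF harmonic that v0(1)] v0(2) by simp
  obtain d where d: "\<And>u. u \<in> I \<Longrightarrow> g1 u = d"
    using I.constant_if_derivative_zero[of g1] second_deriv_g_zero(1)[OF f1]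
      I.smooth_imp_derivative[OF smooth_derivs(5)] by metis
  have d2: "d\<^sup>2 = 1"
    using arc_length[OF u0] f1[OF u0] d[OF u0] by simp
  \<comment> \<open>Since g' is nonzero, the \<open>wedge e (n v)\<close> coefficient upgrades the
    information at \<open>v0\<close> to constancy of \<kappa> on all of \<open>J\<close>.\<close>
  have "\<kappa>1 v = 0" if "v \<in> J" for v
    using harmonic_coefficients(4)[OF harmonic u0 that] d[OF u0] d2 by auto
  then obtain c where c: "\<And>v. v \<in> J \<Longrightarrow> \<kappa> v = c"
    using J.constant_if_derivative_zero[of \<kappa>] curvature_deriv
    by (metis has_real_derivative_iff_has_vector_derivative)
  have "d * (c\<^sup>2 - 1) / (f u0)\<^sup>2 = 0"
    using harmonic_coefficients(2)[OF harmonic u0 v0(1)] second_deriv_g_zero[OF f1 u0]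
      f1[OF u0] d[OF u0] c[OF v0(1)] by simp
  then have "c\<^sup>2 = 1"
    using d2 f_nonzero[OF u0] by auto
  then show ?thesis using that(2) d2 c f1 d by blast
qed

lemma arc_length_line:
  assumes "\<And>u. u \<in> I \<Longrightarrow> f1 u = 0" "\<And>u. u \<in> I \<Longrightarrow> g1 u = d" "d\<^sup>2 = 1"
  shows "\<exists>a b. (\<forall>u\<in>I. f u = a) \<and> ((\<forall>u\<in>I. g u = u + b) \<or> (\<forall>u\<in>I. g u = - u + b))"
proof -
  obtain a where a: "\<And>u. u \<in> I \<Longrightarrow> f u = a"
    using I.constant_if_derivative_zero[of f] assms(1) I.smooth_imp_derivative[OF smooth_f] by metis
  have "((\<lambda>u. g u - d * u) has_vector_derivative 0) (at u within I)" if "u \<in> I" for u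
    using assms(2)[OF that] that
    by (auto simp: has_real_derivative_iff_has_vector_derivative[symmetric]
        intro!: derivative_eq_intros fg_derivs)
  then obtain b where b: "\<And>u. u \<in> I \<Longrightarrow> g u - d * u = b"
    using I.constant_if_derivative_zero by metis
  have "d = 1 \<or> d = -1"
    using assms(3) by (simp add: power2_eq_1_iff)
  then have "(\<forall>u\<in>I. g u = u + b) \<or> (\<forall>u\<in>I. g u = - u + b)"
    using b by force
  then show ?thesis using a by blast
qed

section \<open>The exceptional cylinders: mean curvature and rulings\<close>

lemma mean_curvature_z:
  assumes u: "u \<in> I" and v: "v \<in> J" and "\<And>u. u \<in> I \<Longrightarrow> f1 u = 0"
  shows "mean_curvature I J z u v = (- 1 / (2 * f u)) *\<^sub>R (\<kappa> v *\<^sub>R n v + l v)"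
proof -
  have uu: "partial_deriv I J 1 (\<lambda>u v. partial_deriv I J 1 z u v) u v = 0"
    by (rule partial1_eqI[where \<Psi> = "\<lambda>u. f1 u *\<^sub>R l v + g1 u *\<^sub>R e"])
       (auto simp: u v partial1_z second_deriv_g_zero[OF assms(3)]
          derivative_zero_if_constant[of f1 0, OF assms(3)]
          intro!: derivative_eq_intros fg_derivs)
  have vv: "partial_deriv I J 2 (\<lambda>u v. partial_deriv I J 2 z u v) u v
      = - f u *\<^sub>R (\<kappa> v *\<^sub>R n v + l v)"
    by (rule partial2_eqI[where \<Psi> = "\<lambda>v. f u *\<^sub>R t v"])
       (auto simp: u v partial2_z algebra_simps intro!: derivative_eq_intros t_deriv)
  \<comment> \<open>With f' = 0 the connection terms vanish and z is affine in u, so the mean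
    curvature vector is half of the second v-derivative divided by f^2.\<close>
  show ?thesis
    using f_nonzero[OF u] assms
    by (simp add: mean_curvature_def second_fundamental_form_def sum_2
        inverse_first_fundamental_form_z[OF u v] flat_deriv_coord_field[abs_def]
        flat_deriv_def[of _ _ "levi_civita _ _ _ _ _"] levi_civita_coord_field[OF u v]
        uu vv power2_eq_square algebra_simps)
qed

lemma spacelike_z: "spacelike_surface I J z"
  unfolding spacelike_surface_def
proof (intro ballI allI impI)
  fix u v and w :: "real^2" assume u: "u \<in> I" and v: "v \<in> J" and "w \<noteq> 0"
  then have "w $ 1 \<noteq> 0 \<or> w $ 2 \<noteq> 0"
    by (auto simp: vec_eq_iff forall_2)
  then have "(w $ 1)\<^sup>2 + (f u * w $ 2)\<^sup>2 > 0"
    using f_nonzero[OF u] by (auto simp: sum_power2_gt_zero_iff)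
  then show "w \<bullet> (first_fundamental_form I J z u v *v w) > 0"
    by (simp add: inner_vec_def matrix_vector_mult_def sum_2 first_fundamental_form_z[OF u v]
        power2_eq_square algebra_simps)
qed

text \<open>The \<open>l\<close> component of \<kappa> n + l is always 1, which keeps the mean
  curvature vector nonzero even where its square, proportional to 1 - \<kappa>^2, vanishes.\<close>

lemma cylindrical_imp_marginally_trapped:
  assumes "(\<forall>v\<in>J. \<kappa> v = 1) \<or> (\<forall>v\<in>J. \<kappa> v = -1)" and f1: "\<And>u. u \<in> I \<Longrightarrow> f1 u = 0"
  shows "marginally_trapped I J z"
  unfolding marginally_trapped_def
proof (intro conjI spacelike_z ballI)
  fix u v assume u: "u \<in> I" and v: "v \<in> J"
  have "mink (mean_curvature I J z u v) (l v) \<noteq> 0"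
    using f_nonzero[OF u] frame_products[OF v]
    by (simp add: mean_curvature_z[OF u v f1] mink_simps)
  then show "mean_curvature I J z u v \<noteq> 0"
    by (auto simp: mink_simps)
  have "(\<kappa> v)\<^sup>2 = 1"
    using assms(1) v by auto
  then show "mink (mean_curvature I J z u v) (mean_curvature I J z u v) = 0"
    using frame_products[OF v]
    by (simp add: mean_curvature_z[OF u v f1] mink_simps power2_eq_square)
qed

text \<open>The surface is a cylinder with generators parallel to \<open>e\<close> over the curve
  \<open>a *\<^sub>R l v + b *\<^sub>R e\<close>; its coordinate vectors
  \<open>d *\<^sub>R e\<close> and \<open>a *\<^sub>R t v\<close> do not change along a
  generator.\<close>

lemma cylinder_developable_ruled:
  assumes f: "\<And>u. u \<in> I \<Longrightarrow> f u = a" and g: "\<And>u. u \<in> I \<Longrightarrow> g u = d * u + b"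
    and "d \<noteq> 0"
  shows "developable_ruled I J z"
proof -
  have g1: "g1 u = d" if "u \<in> I" for u
    by (rule I.deriv_on_eqI[OF that _ g])
       (auto simp: has_real_derivative_iff_has_vector_derivative[symmetric]
         intro!: derivative_eq_intros)
  have smooth: "smooth_on_interval J (\<lambda>v. a *\<^sub>R l v + b *\<^sub>R e)" "smooth_on_interval J (\<lambda>v. d *\<^sub>R e)"
    using J.smooth_scaleR_add_const[OF smooth_l, of a "b *\<^sub>R e"]
      J.smooth_scaleR_add_const[OF smooth_l, of 0 "d *\<^sub>R e"] by simp_all
  have "d *\<^sub>R e \<noteq> 0"
    using \<open>d \<noteq> 0\<close> by (simp add: axis_eq_0_iff)
  moreover have "z u v = (a *\<^sub>R l v + b *\<^sub>R e) + u *\<^sub>R (d *\<^sub>R e)" if "u \<in> I" for u v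
    using f[OF that] g[OF that] by (simp add: meridian_surface_def algebra_simps)
  moreover have "partial_deriv I J 1 z u v = d *\<^sub>R e" "partial_deriv I J 2 z u v = a *\<^sub>R t v"
    if "u \<in> I" "v \<in> J" for u v
    using that f g1 derivative_zero_if_constant[of f a] by (simp_all add: partial1_z partial2_z)
  ultimately show ?thesis
    unfolding developable_ruled_def using smooth
    by (intro conjI exI[of _ "\<lambda>v. a *\<^sub>R l v + b *\<^sub>R e"] exI[of _ "\<lambda>v. d *\<^sub>R e"]) auto
qed

end

theorem theorem4p2:
  fixes I J :: "real set"
    and f g :: "real \<Rightarrow> real"
    and l n :: "real \<Rightarrow> real^4"
  assumes "is_interval I" and "interior I \<noteq> {}"
    and "is_interval J" and "interior J \<noteq> {}"
    and "smooth_on_interval I f" and "smooth_on_interval I g"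
    and "\<forall>u\<in>I. f u > 0"
    and "\<forall>u\<in>I. (deriv_on I f u)\<^sup>2 + (deriv_on I g u)\<^sup>2 = 1"
    and "smooth_on_interval J l"
    and "\<forall>v\<in>J. l v \<in> de_sitter"
    and "\<forall>v\<in>J. mink (deriv_on J l v) (deriv_on J l v) = 1"
    and "smooth_on_interval J n"
    and "\<forall>v\<in>J. n v \<in> mink3 \<and> mink (n v) (n v) = -1 \<and>
            mink (n v) (l v) = 0 \<and> mink (n v) (deriv_on J l v) = 0"
  shows "(harmonic_gauss_map I J f g l \<longleftrightarrow>
            part_of_plane I J (meridian_surface f g l) \<or>
            (((\<forall>v\<in>J. spherical_curvature J l n v = 1) \<or> (\<forall>v\<in>J. spherical_curvature J l n v = -1)) \<and>
             (\<exists>a b. (\<forall>u\<in>I. f u = a) \<and> ((\<forall>u\<in>I. g u = u + b) \<or> (\<forall>u\<in>I. g u = - u + b)))))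
         \<and> (((\<forall>v\<in>J. spherical_curvature J l n v = 1) \<or> (\<forall>v\<in>J. spherical_curvature J l n v = -1)) \<and>
             (\<exists>a b. (\<forall>u\<in>I. f u = a) \<and> ((\<forall>u\<in>I. g u = u + b) \<or> (\<forall>u\<in>I. g u = - u + b)))
            \<longrightarrow> marginally_trapped I J (meridian_surface f g l) \<and>
                developable_ruled I J (meridian_surface f g l))"
    (is "(?harmonic \<longleftrightarrow> ?plane \<or> ?curvature \<and> ?line) \<and> (?curvature \<and> ?line \<longrightarrow> ?trapped \<and> ?ruled)")
proof -
  interpret meridian I J f g l n
    by (unfold_locales; use assms in blast)
  have f1: "deriv_on I f u = 0" if ?line "u \<in> I" for u
  proof -
    from that(1) obtain a where "\<And>u. u \<in> I \<Longrightarrow> f u = a" by blast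
    then show ?thesis using that(2) by (rule derivative_zero_if_constant)
  qed
  have ruled: ?ruled if ?line
  proof -
    \<comment> \<open>Writing the slopes as factors 1 and -1 brings both signs into the common form
      \<open>d * u + b\<close>.\<close>
    from that obtain a b where f: "\<And>u. u \<in> I \<Longrightarrow> f u = a"
        and g: "(\<forall>u\<in>I. g u = 1 * u + b) \<or> (\<forall>u\<in>I. g u = (-1) * u + b)"
      by auto
    from g show ?thesis
    proof
      assume "\<forall>u\<in>I. g u = 1 * u + b"
      then show ?thesis
        using cylinder_developable_ruled[OF f, of 1 b] by simp
    next
      assume "\<forall>u\<in>I. g u = (-1) * u + b"
      then show ?thesis
        using cylinder_developable_ruled[OF f, of "-1" b] by simp
    qed
  qed
  have "?plane \<or> ?curvature \<and> ?line" if ?harmonic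
    using that
  proof (cases rule: harmonic_imp_planar_or_cylindrical)
    case 1
    then have ?plane by (rule planar_imp_part_of_plane)
    then show ?thesis ..
  next
    case (2 c d)
    from 2(1) have "c = 1 \<or> c = -1"
      by (simp add: power2_eq_1_iff)
    then have ?curvature using 2(3) by blast
    moreover have ?line using arc_length_line[OF 2(4,5,2)] .
    ultimately show ?thesis by blast
  qed
  moreover have ?harmonic if ?plane
  proof -
    \<comment> \<open>The pointwise criterion takes a pair of parameters, so each of its two
      conclusions borrows a base point from the other interval.\<close>
    obtain u0 v0 where "u0 \<in> I" "v0 \<in> J"
      using I.nonempty J.nonempty by blast
    then show ?thesis
      using part_of_plane_imp_planar[OF that] by (intro planar_imp_harmonic) simp_all
  qed
  moreover have ?harmonic if ?curvature ?line
    by (rule cylindrical_imp_harmonic[OF that(1) f1[OF that(2)]])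
  moreover have ?trapped if ?curvature ?line
    by (rule cylindrical_imp_marginally_trapped[OF that(1) f1[OF that(2)]])
  ultimately show ?thesis using ruled by blast
qed

end
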